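(* Let $(G,\phi)$ be a finite or infinite weighted graph. Let $\mathcal F=\{(G[A],\phi|_{E(G[A])}): A\subseteq V(G),\ |A|<\infty\}$. Let $n\in\mathbb N$ and let $f$ be an $n$-dimensional control function of $\mathcal F$. Let $g:\mathbb{R}^+\to\mathbb{R}^+$ be defined by $g(x)=f(x+1)$. Then $g$ is an $n$-dimensional control function of $(G,\phi)$. In particular, $\mathrm{asdim}((G,\phi))\le\mathrm{asdim}(\mathcal F)$.
   Context: A weighted graph $(G,\phi)$ is a simple (possibly infinite) graph $G$ with $\phi:E(G)\to\mathbb{R}^+$, identified with the pseudometric space $(V(G),d_{(G,\phi)})$, where $d_{(G,\phi)}(x,y)$ is the infimum of total weights of paths between $x$ and $y$ ($\infty$ if none); each induced weighted subgraph $(G[A],\phi|_{E(G[A])})$ carries its own intrinsic such distance. For a pseudometric space $(X,d)$, a family $\mathcal U$ of subsets is $D$-bounded if each member has diameter at most $D$, and $r$-disjoint if $d(a,b)>r$ for $a,b$ in different members. A function $D_X:\mathbb{R}^+\to\mathbb{R}^+$ is an $n$-dimensional control function for $(X,d)$ if for every $r>0$ there is a cover $\bigcup_{i=1}^{n+1}\mathcal U_i$ of $X$ with each $\mathcal U_i$ $r$-disjoint and each member $D_X(r)$-bounded; it is an $n$-dimensional control function of a family if it is one for every member. $\mathrm{asdim}$ is the least $n$ admitting such a function. *)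

theory Defs
  imports
    "HOL-Library.Extended_Nat"
    "HOL-Library.Extended_Nonnegative_Real"
    "HOL-Library.FuncSet"
begin

section \<open>Control functions and asymptotic dimension\<close>

text \<open>
  A pseudometric space is a carrier together with a distance that may be infinite.
  The distance is only looked at on the carrier.
\<close>

type_synonym 'a pmspace = "'a set \<times> ('a \<Rightarrow> 'a \<Rightarrow> ennreal)"

definition pm_diam :: "('a \<Rightarrow> 'a \<Rightarrow> ennreal) \<Rightarrow> 'a set \<Rightarrow> ennreal" where
  "pm_diam d U = (SUP (x, y) \<in> U \<times> U. d x y)"

definition pm_bounded :: "('a \<Rightarrow> 'a \<Rightarrow> ennreal) \<Rightarrow> real \<Rightarrow> 'a set set \<Rightarrow> bool" where
  "pm_bounded d D \<U> \<longleftrightarrow> (\<forall>U\<in>\<U>. pm_diam d U \<le> ennreal D)"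

definition pm_disjoint :: "('a \<Rightarrow> 'a \<Rightarrow> ennreal) \<Rightarrow> real \<Rightarrow> 'a set set \<Rightarrow> bool" where
  "pm_disjoint d r \<U> \<longleftrightarrow>
     (\<forall>U\<in>\<U>. \<forall>W\<in>\<U>. U \<noteq> W \<longrightarrow> (\<forall>a\<in>U. \<forall>b\<in>W. ennreal r < d a b))"

text \<open>
  Functions from the positive reals to the positive reals are represented by total
  functions on the reals that are positive at positive arguments; their values
  elsewhere are irrelevant.
\<close>

definition control_function :: "nat \<Rightarrow> (real \<Rightarrow> real) \<Rightarrow> 'a pmspace \<Rightarrow> bool" where
  "control_function n D S \<longleftrightarrow>
     (\<forall>r>0. D r > 0) \<and>
     (\<forall>r>0. \<exists>\<U> :: nat \<Rightarrow> 'a set set.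
        (\<Union>i\<in>{1..n+1}. \<Union>(\<U> i)) = fst S \<and>
        (\<forall>i\<in>{1..n+1}. pm_disjoint (snd S) r (\<U> i) \<and> pm_bounded (snd S) (D r) (\<U> i)))"

definition family_control_function :: "nat \<Rightarrow> (real \<Rightarrow> real) \<Rightarrow> 'a pmspace set \<Rightarrow> bool" where
  "family_control_function n D \<F> \<longleftrightarrow>
     (\<forall>r>0. D r > 0) \<and> (\<forall>S\<in>\<F>. control_function n D S)"

text \<open>The infimum of the empty set is \<open>\<infinity>\<close>, the value when no control function exists.\<close>

definition asdim :: "'a pmspace \<Rightarrow> enat" where
  "asdim S = (INF n \<in> {n. \<exists>D. control_function n D S}. enat n)"

definition family_asdim :: "'a pmspace set \<Rightarrow> enat" where
  "family_asdim \<F> = (INF n \<in> {n. \<exists>D. family_control_function n D \<F>}. enat n)"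


section \<open>Weighted graphs\<close>

text \<open>Edges are two-element sets of vertices; weights are only meaningful on edges.\<close>

record 'a wgraph =
  verts :: "'a set"
  edges :: "'a set set"
  weight :: "'a set \<Rightarrow> real"

definition weighted_graph :: "'a wgraph \<Rightarrow> bool" where
  "weighted_graph G \<longleftrightarrow>
     (\<forall>e\<in>edges G. e \<subseteq> verts G \<and> card e = 2) \<and>
     (\<forall>e\<in>edges G. weight G e > 0)"

text \<open>Paths are given by their vertex sequences; \<open>[x]\<close> is the trivial path of length 0.\<close>

definition is_path :: "'a wgraph \<Rightarrow> 'a \<Rightarrow> 'a list \<Rightarrow> 'a \<Rightarrow> bool" where
  "is_path G x p y \<longleftrightarrow>
     p \<noteq> [] \<and> hd p = x \<and> last p = y \<and> distinct p \<and> set p \<subseteq> verts G \<and>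
     successively (\<lambda>u v. {u, v} \<in> edges G) p"

definition path_weight :: "'a wgraph \<Rightarrow> 'a list \<Rightarrow> real" where
  "path_weight G p = (\<Sum>i<length p - 1. weight G {p ! i, p ! Suc i})"

text \<open>The infimum of the empty set is \<open>\<infinity>\<close>, the distance when no path exists.\<close>

definition graph_dist :: "'a wgraph \<Rightarrow> 'a \<Rightarrow> 'a \<Rightarrow> ennreal" where
  "graph_dist G x y = (INF p \<in> {p. is_path G x p y}. ennreal (path_weight G p))"

definition graph_space :: "'a wgraph \<Rightarrow> 'a pmspace" where
  "graph_space G = (verts G, graph_dist G)"

definition induced_wgraph :: "'a wgraph \<Rightarrow> 'a set \<Rightarrow> 'a wgraph" where
  "induced_wgraph G A =
     \<lparr>verts = A, edges = {e \<in> edges G. e \<subseteq> A},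
      weight = restrict (weight G) {e \<in> edges G. e \<subseteq> A}\<rparr>"

definition finite_induced_spaces :: "'a wgraph \<Rightarrow> 'a pmspace set" where
  "finite_induced_spaces G =
     {graph_space (induced_wgraph G A) | A. A \<subseteq> verts G \<and> finite A}"

end

theory Submission imports Defs begin

text \<open>
  This is a compactness argument. Fix \<open>r\<close> and choose for every finite \<open>A\<close> an
  \<open>(r + 1)\<close>-disjoint, \<open>f (r + 1)\<close>-bounded cover of \<open>G[A]\<close>. Along an ultrafilter refining the
  filter of increasing finite vertex sets, every vertex has a limiting colour, and declaring two
  vertices equivalent if they eventually lie in a common member of the cover gives the limit
  cover. It stays bounded since the distance of \<open>G\<close> is at most that of \<open>G[A]\<close>. It is
  \<open>r\<close>-disjoint since vertices at distance at most \<open>r\<close> are joined by a path of weight less than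
  \<open>r + 1\<close>, which lies in \<open>G[A]\<close> for all large \<open>A\<close>; the \<open>1\<close> is needed because the infimum
  defining the distance need not be attained.
\<close>

text \<open>Zorn's lemma yields a minimal proper filter \<open>H\<close> below \<open>F\<close>. If
  \<open>H\<close> does not refute \<open>P\<close>, cutting \<open>H\<close> down to
  \<open>P\<close> leaves a proper filter, which by minimality is \<open>H\<close> itself.\<close>

lemma ultrafilter_refinement:
  fixes F :: "'a filter"
  assumes "F \<noteq> bot"
  shows "\<exists>H\<le>F. H \<noteq> bot \<and> (\<forall>P. eventually P H \<or> eventually (\<lambda>x. \<not> P x) H)"
proof -
  let ?S = "{H. H \<noteq> bot \<and> H \<le> F}"
  have "\<exists>m\<in>?S. \<forall>a\<in>?S. m \<ge> a \<longrightarrow> a = m"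
  proof (rule predicate_Zorn)
    show "partial_order_on ?S (relation_of (\<ge>) ?S)"
      by (rule partial_order_on_relation_ofI) auto
    fix C assume C: "C \<in> Chains (relation_of (\<ge>) ?S)"
    show "\<exists>u\<in>?S. \<forall>a\<in>C. a \<ge> u"
    proof (cases "C = {}")
      case True
      then show ?thesis using assms by auto
    next
      case False
      have sub: "C \<subseteq> ?S" using C by (auto simp: Chains_def relation_of_def)
      have total: "X \<le> Y \<or> Y \<le> X" if "X \<in> C" "Y \<in> C" for X Y
        using C that by (auto simp: Chains_def relation_of_def)
      \<comment> \<open>Any two members of a chain are comparable, so they form a filter base:
        whatever holds eventually along the infimum already does along some member, and
        \<open>False\<close> does so along none.\<close>
      have "eventually P (Inf C) \<longleftrightarrow> (\<exists>b\<in>C. eventually P b)" for P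
        using False total by (intro eventually_Inf_base) (auto intro: order_refl)
      then have "Inf C \<noteq> bot"
        using sub by (auto simp: trivial_limit_def)
      moreover have "Inf C \<le> F"
        using False sub by (auto intro: Inf_lower2)
      ultimately show ?thesis by (auto intro: Inf_lower)
    qed
  qed
  then obtain H where H: "H \<noteq> bot" "H \<le> F"
    and maximal: "\<And>K. K \<noteq> bot \<Longrightarrow> K \<le> F \<Longrightarrow> K \<le> H \<Longrightarrow> K = H"
    by auto
  have "eventually P H \<or> eventually (\<lambda>x. \<not> P x) H" for P
  proof (cases "inf H (principal {x. P x}) = bot")
    case True
    then show ?thesis
      by (auto simp: trivial_limit_def eventually_inf_principal)
  next
    case False
    then have "inf H (principal {x. P x}) = H"
      using H by (intro maximal) (auto intro: le_infI1)
    moreover have "eventually P (inf H (principal {x. P x}))"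
      by (simp add: eventually_inf_principal)
    ultimately show ?thesis by simp
  qed
  with H show ?thesis by blast
qed

text \<open>Otherwise each value in \<open>I\<close> would be avoided eventually, hence all of them
  at once, as \<open>I\<close> is finite. This supplies the limiting colours.\<close>

lemma ultrafilter_finite_cases:
  assumes "finite I" "H \<noteq> bot"
    and ultra: "\<And>P. eventually P H \<or> eventually (\<lambda>x. \<not> P x) H"
    and ev: "eventually (\<lambda>x. c x \<in> I) H"
  shows "\<exists>i\<in>I. eventually (\<lambda>x. c x = i) H"
proof (rule ccontr)
  assume "\<not> ?thesis"
  then have "eventually (\<lambda>x. \<forall>i\<in>I. c x \<noteq> i) H"
    using ultra assms(1) by (subst eventually_ball_finite_distrib) blast+
  with ev have "eventually (\<lambda>x. False) H"
    by eventually_elim auto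
  with \<open>H \<noteq> bot\<close> show False by simp
qed

lemma is_path_induced_iff:
  assumes "A \<subseteq> verts G"
  shows "is_path (induced_wgraph G A) x p y \<longleftrightarrow> is_path G x p y \<and> set p \<subseteq> A"
proof -
  have "successively (\<lambda>u v. {u, v} \<in> edges G \<and> {u, v} \<subseteq> A) p \<longleftrightarrow>
        successively (\<lambda>u v. {u, v} \<in> edges G) p" if "set p \<subseteq> A"
    using that by (intro successively_cong) auto
  then show ?thesis
    using assms by (auto simp: is_path_def induced_wgraph_def)
qed

text \<open>The induced weight is restricted to the edges inside \<open>A\<close>, so agreement
  rests on consecutive path vertices forming such edges.\<close>

lemma path_weight_induced:
  assumes "is_path (induced_wgraph G A) x p y"
  shows "path_weight (induced_wgraph G A) p = path_weight G p"
  unfolding path_weight_def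
proof (rule sum.cong)
  fix i assume "i \<in> {..<length p - 1}"
  then have "{p ! i, p ! Suc i} \<in> edges (induced_wgraph G A)"
    using assms by (auto simp: is_path_def successively_conv_nth)
  then show "weight (induced_wgraph G A) {p ! i, p ! Suc i} = weight G {p ! i, p ! Suc i}"
    by (auto simp: induced_wgraph_def)
qed simp

text \<open>Passing to \<open>A\<close> only removes paths and keeps the weights of the others, so
  the infimum can only grow.\<close>

lemma graph_dist_le_induced:
  assumes "A \<subseteq> verts G"
  shows "graph_dist G x y \<le> graph_dist (induced_wgraph G A) x y"
  unfolding graph_dist_def
proof (rule INF_mono)
  fix p assume p: "p \<in> {p. is_path (induced_wgraph G A) x p y}"
  then show "\<exists>q\<in>{p. is_path G x p y}.
      ennreal (path_weight G q) \<le> ennreal (path_weight (induced_wgraph G A) p)"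
    using is_path_induced_iff[OF assms] path_weight_induced[of G A x p y] by auto
qed

lemma graph_dist_induced_le_path_weight:
  assumes "A \<subseteq> verts G" "is_path G x p y" "set p \<subseteq> A"
  shows "graph_dist (induced_wgraph G A) x y \<le> ennreal (path_weight G p)"
proof -
  have p: "is_path (induced_wgraph G A) x p y"
    using assms by (simp add: is_path_induced_iff)
  show ?thesis
    unfolding graph_dist_def path_weight_induced[OF p, symmetric]
    using p by (intro INF_lower) simp
qed

lemma pm_bounded_iff:
  "pm_bounded d D \<U> \<longleftrightarrow> (\<forall>U\<in>\<U>. \<forall>x\<in>U. \<forall>y\<in>U. d x y \<le> ennreal D)"
  by (auto simp: pm_bounded_def pm_diam_def SUP_le_iff)

text \<open>Each point picks one member \<open>m x\<close> containing it and the index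
  \<open>c x\<close> of its family. Such functions can be compared pointwise as the finite set
  varies; disjointness appears in contrapositive form.\<close>

lemma control_function_colouring:
  assumes "control_function n D (V, d)" "r > 0"
  shows "\<exists>(c :: 'a \<Rightarrow> nat) (m :: 'a \<Rightarrow> 'a set). (\<forall>x\<in>V. c x \<in> {1..n+1}) \<and>
    (\<forall>x\<in>V. \<forall>y\<in>V. c x = c y \<and> m x = m y \<longrightarrow> d x y \<le> ennreal (D r)) \<and>
    (\<forall>x\<in>V. \<forall>y\<in>V. c x = c y \<and> d x y \<le> ennreal r \<longrightarrow> m x = m y)"
proof -
  have "\<exists>\<U> :: nat \<Rightarrow> 'a set set. (\<Union>i\<in>{1..n+1}. \<Union>(\<U> i)) = V \<and>
      (\<forall>i\<in>{1..n+1}. pm_disjoint d r (\<U> i) \<and> pm_bounded d (D r) (\<U> i))"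
    using assms unfolding control_function_def fst_conv snd_conv by blast
  then obtain \<U> :: "nat \<Rightarrow> 'a set set" where cov: "(\<Union>i\<in>{1..n+1}. \<Union>(\<U> i)) = V"
    and dis: "\<And>i. i \<in> {1..n+1} \<Longrightarrow> pm_disjoint d r (\<U> i)"
    and bdd: "\<And>i. i \<in> {1..n+1} \<Longrightarrow> pm_bounded d (D r) (\<U> i)"
    by blast
  have "\<forall>x\<in>V. \<exists>i U. i \<in> {1..n+1} \<and> U \<in> \<U> i \<and> x \<in> U"
    using cov by blast
  then obtain c m where cm: "\<And>x. x \<in> V \<Longrightarrow> c x \<in> {1..n+1} \<and> m x \<in> \<U> (c x) \<and> x \<in> m x"
    by metis
  have "d x y \<le> ennreal (D r)" if "x \<in> V" "y \<in> V" "c x = c y" "m x = m y" for x y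
    using cm[OF that(1)] cm[OF that(2)] bdd that unfolding pm_bounded_iff by metis
  moreover have "m x = m y" if "x \<in> V" "y \<in> V" "c x = c y" "d x y \<le> ennreal r" for x y
    using cm[OF that(1)] cm[OF that(2)] dis that unfolding pm_disjoint_def by (metis not_le)
  ultimately show ?thesis
    using cm by blast
qed

lemma control_function_from_finite_induced:
  fixes G :: "'a wgraph"
  assumes fam: "family_control_function n f (finite_induced_spaces G)"
  shows "control_function n (\<lambda>x. f (x + 1)) (graph_space G)"
  unfolding control_function_def
proof (intro conjI allI impI)
  fix r :: real assume "r > 0"
  then show "f (r + 1) > 0"
    using fam by (auto simp: family_control_function_def)
next
  fix r :: real assume r: "r > 0"
  define V where "V = verts G"
  define dA where "dA A = graph_dist (induced_wgraph G A)" for A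
  define good where "good A c m \<longleftrightarrow> (\<forall>x\<in>A. c x \<in> {1..n+1}) \<and>
      (\<forall>x\<in>A. \<forall>y\<in>A. c x = c y \<and> m x = m y \<longrightarrow> dA A x y \<le> ennreal (f (r + 1))) \<and>
      (\<forall>x\<in>A. \<forall>y\<in>A. c x = c y \<and> dA A x y \<le> ennreal (r + 1) \<longrightarrow> m x = m y)"
    for A and c :: "'a \<Rightarrow> nat" and m :: "'a \<Rightarrow> 'a set"
  have "\<exists>c m. good A c m"
    if A: "finite A \<and> A \<subseteq> V" for A
  proof -
    have "graph_space (induced_wgraph G A) \<in> finite_induced_spaces G"
      using A by (auto simp: finite_induced_spaces_def V_def)
    moreover have "graph_space (induced_wgraph G A) = (A, dA A)"
      by (simp add: graph_space_def dA_def induced_wgraph_def)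
    ultimately have cf: "control_function n f (A, dA A)"
      using fam by (auto simp: family_control_function_def)
    have "r + 1 > 0" using r by simp
    with cf show ?thesis
      unfolding good_def by (rule control_function_colouring)
  qed
  then obtain c m where good: "\<And>A. finite A \<and> A \<subseteq> V \<Longrightarrow> good A (c A) (m A)"
    by metis
  have col: "c A x \<in> {1..n+1}" if "finite A \<and> A \<subseteq> V" "x \<in> A" for A x
    using good[OF that(1)] that(2-) unfolding good_def by blast
  have bdd: "dA A x y \<le> ennreal (f (r + 1))"
    if "finite A \<and> A \<subseteq> V" "x \<in> A" "y \<in> A" "c A x = c A y" "m A x = m A y" for A x y
    using good[OF that(1)] that(2-) unfolding good_def by blast
  have dis: "m A x = m A y"
    if "finite A \<and> A \<subseteq> V" "x \<in> A" "y \<in> A" "c A x = c A y" "dA A x y \<le> ennreal (r + 1)" for A x y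
    using good[OF that(1)] that(2-) unfolding good_def by blast
  obtain H where H: "H \<le> finite_subsets_at_top V" "H \<noteq> bot"
    and ultra: "\<And>P. eventually P H \<or> eventually (\<lambda>A. \<not> P A) H"
    using ultrafilter_refinement[OF finite_subsets_at_top_neq_bot[of V]] by blast
  have ev_supset: "eventually (\<lambda>A. finite A \<and> A \<subseteq> V \<and> B \<subseteq> A) H" if "finite B" "B \<subseteq> V" for B
    using that by (intro filter_leD[OF H(1)]) (auto simp: eventually_finite_subsets_at_top)
  have colour: "\<exists>i\<in>{1..n+1}. eventually (\<lambda>A. c A x = i) H" if "x \<in> V" for x
  proof (rule ultrafilter_finite_cases[OF _ H(2) ultra])
    \<comment> \<open>Colours are controlled only for vertices of \<open>A\<close>, so
      \<open>A\<close> must first be large enough to contain \<open>x\<close>.\<close>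
    have "eventually (\<lambda>A. finite A \<and> A \<subseteq> V \<and> {x} \<subseteq> A) H"
      using that by (intro ev_supset) auto
    then show "eventually (\<lambda>A. c A x \<in> {1..n+1}) H"
      by (rule eventually_mono) (use col in blast)
  qed simp

  \<comment> \<open>The members \<open>m A x\<close> themselves need not converge; only whether two
    vertices share a member has a limit along \<open>H\<close>. The representative \<open>x\<close>
    gets its colour \<open>i\<close> in the definition of \<open>\<U>\<close>.\<close>
  define cls where "cls i x = {y\<in>V. eventually (\<lambda>A. c A y = i \<and> m A y = m A x) H}" for i x
  define \<U> where "\<U> i = {cls i x | x. x \<in> V \<and> eventually (\<lambda>A. c A x = i) H}" for i
  show "\<exists>\<U> :: nat \<Rightarrow> 'a set set.
        (\<Union>i\<in>{1..n+1}. \<Union>(\<U> i)) = fst (graph_space G) \<and>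
        (\<forall>i\<in>{1..n+1}. pm_disjoint (snd (graph_space G)) r (\<U> i) \<and>
           pm_bounded (snd (graph_space G)) (f (r + 1)) (\<U> i))"
  proof (intro exI[of _ \<U>] conjI ballI)
    have "x \<in> (\<Union>i\<in>{1..n+1}. \<Union>(\<U> i))" if x: "x \<in> V" for x
    proof -
      obtain i where i: "i \<in> {1..n+1}" "eventually (\<lambda>A. c A x = i) H"
        using colour[OF x] by blast
      then have "x \<in> cls i x" "cls i x \<in> \<U> i"
        using x by (auto simp: cls_def \<U>_def)
      with i show ?thesis by blast
    qed
    then show "(\<Union>i\<in>{1..n+1}. \<Union>(\<U> i)) = fst (graph_space G)"
      by (auto simp: \<U>_def cls_def graph_space_def V_def)
  next
    fix i
    show "pm_bounded (snd (graph_space G)) (f (r + 1)) (\<U> i)"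
      unfolding pm_bounded_iff
    proof (intro ballI)
      fix U y z assume U: "U \<in> \<U> i" "y \<in> U" "z \<in> U"
      then obtain x where y: "y \<in> V" "eventually (\<lambda>A. c A y = i \<and> m A y = m A x) H"
        and z: "z \<in> V" "eventually (\<lambda>A. c A z = i \<and> m A z = m A x) H"
        by (auto simp: \<U>_def cls_def)
      \<comment> \<open>The inequality does not depend on \<open>A\<close>, so holding eventually
        along the proper filter \<open>H\<close> makes it true.\<close>
      have "eventually (\<lambda>A. graph_dist G y z \<le> ennreal (f (r + 1))) H"
        using y(2) z(2) ev_supset[of "{y, z}", simplified, OF conjI[OF y(1) z(1)]]
      proof eventually_elim
        case (elim A)
        have "graph_dist G y z \<le> dA A y z"
          using elim unfolding dA_def V_def by (intro graph_dist_le_induced) auto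
        also have "\<dots> \<le> ennreal (f (r + 1))"
          using elim by (intro bdd) auto
        finally show ?case .
      qed
      then show "snd (graph_space G) y z \<le> ennreal (f (r + 1))"
        using H(2) by (simp add: graph_space_def)
    qed
    show "pm_disjoint (snd (graph_space G)) r (\<U> i)"
      unfolding pm_disjoint_def
    proof (intro ballI impI, rule ccontr)
      fix U W a b
      assume UW: "U \<in> \<U> i" "W \<in> \<U> i" "U \<noteq> W" "a \<in> U" "b \<in> W"
      assume "\<not> ennreal r < snd (graph_space G) a b"
      then have "graph_dist G a b \<le> ennreal r" by (simp add: graph_space_def)
      also have "\<dots> < ennreal (r + 1)" using r by (simp add: ennreal_less_iff)
      finally obtain p where p: "is_path G a p b" "ennreal (path_weight G p) < ennreal (r + 1)"
        by (auto simp: graph_dist_def INF_less_iff)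
      obtain x z where U: "U = cls i x" and W: "W = cls i z"
        using UW by (auto simp: \<U>_def)
      have a: "eventually (\<lambda>A. c A a = i \<and> m A a = m A x) H"
        and b: "eventually (\<lambda>A. c A b = i \<and> m A b = m A z) H"
        using UW by (auto simp: U W cls_def)
      have ends: "a \<in> set p" "b \<in> set p" and pV: "set p \<subseteq> V"
        using p(1) by (auto simp: is_path_def V_def)
      \<comment> \<open>Once \<open>A\<close> contains \<open>p\<close>, its ends \<open>a\<close>
        and \<open>b\<close> have colour \<open>i\<close> and are within \<open>r + 1\<close> in the
        induced graph, so they share a member; this links the representatives \<open>x\<close> and
        \<open>z\<close>.\<close>
      have "eventually (\<lambda>A. m A x = m A z) H"
        using a b ev_supset[OF finite_set pV]
      proof eventually_elim
        case (elim A)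
        have "dA A a b \<le> ennreal (path_weight G p)"
          using elim p(1) unfolding dA_def V_def
          by (intro graph_dist_induced_le_path_weight) auto
        then have "dA A a b \<le> ennreal (r + 1)"
          using p(2) by (meson order.strict_implies_order order_trans)
        then have "m A a = m A b"
          using elim ends by (intro dis) auto
        then show ?case using elim by simp
      qed
      \<comment> \<open>Eventual agreement at the representatives carries over to every vertex
        \<open>y\<close>, so the two classes are equal.\<close>
      then have "eventually (\<lambda>A. c A y = i \<and> m A y = m A x) H \<longleftrightarrow>
          eventually (\<lambda>A. c A y = i \<and> m A y = m A z) H" for y
        by (intro eventually_subst) (auto elim: eventually_mono)
      then have "U = W"
        by (simp add: U W cls_def)
      with UW show False by blast
    qed
  qed
qed

theorem theoremA2:
  fixes G :: "'a wgraph"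
  assumes "weighted_graph G"
  shows "(\<forall>(n::nat) (f::real \<Rightarrow> real).
            family_control_function n f (finite_induced_spaces G) \<longrightarrow>
            control_function n (\<lambda>x. f (x + 1)) (graph_space G)) \<and>
         asdim (graph_space G) \<le> family_asdim (finite_induced_spaces G)"
proof
  show "\<forall>n f. family_control_function n f (finite_induced_spaces G) \<longrightarrow>
          control_function n (\<lambda>x. f (x + 1)) (graph_space G)"
    by (blast intro: control_function_from_finite_induced)
  \<comment> \<open>Every dimension admissible for the family is admissible for \<open>G\<close>
    through the shifted function, so the left infimum ranges over a larger set; if the family admits
    none, the right side is infinite.\<close>
  then show "asdim (graph_space G) \<le> family_asdim (finite_induced_spaces G)"
    unfolding asdim_def family_asdim_def by (intro INF_superset_mono) auto
qed

end
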